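(* Let $S\in(0,\infty)$ and let $\phi\in L^\infty(0,S)$ be a nonnegative function. Suppose that there exist a constant $a\ge0$, a nonnegative function $g\in L^1_{\rm loc}([0,\infty))$ and a nondecreasing function $M:[0,\infty)\to[0,\infty)$ such that $$\phi(t)\le a+[g*M(\phi(\cdot))](t)\quad\text{for a.e. } t\in(0,S).$$ Then there exists a constant $R>0$ which depends only on $M(a+1)$ and $g$ such that $$\|\phi\|_{L^\infty(0,\min\{R,S\})}\le a+1.$$
   Context: Convolution: $(g*w)(t)=\int_0^tg(t-s)w(s)\,\mathrm{d}s$. *)

theory Defs
  imports "HOL-Analysis.Analysis" "HOL-Probability.Essential_Supremum"
begin

(* The essential supremum is taken in ennreal, so the norm over a null set is 0;
   over ereal it would be minus infinity. *)
definition Linfty_norm :: "real set \<Rightarrow> (real \<Rightarrow> real) \<Rightarrow> ennreal" where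
  "Linfty_norm A f = esssup (lebesgue_on A) (\<lambda>x. ennreal \<bar>f x\<bar>)"

(* Members are representatives, total functions whose values outside A are irrelevant. *)
definition Linfty :: "real set \<Rightarrow> (real \<Rightarrow> real) set" where
  "Linfty A = {f \<in> borel_measurable (lebesgue_on A). Linfty_norm A f < \<infinity>}"

(* Compact subsets of A itself are used: for A = {0..} this includes the intervals {0..T},
   so functions in L1_loc {0..} are integrable up to 0. *)
definition L1_loc :: "real set \<Rightarrow> (real \<Rightarrow> real) set" where
  "L1_loc A = {g. \<forall>K. compact K \<and> K \<subseteq> A \<longrightarrow> set_integrable lebesgue K g}"

definition conv :: "(real \<Rightarrow> real) \<Rightarrow> (real \<Rightarrow> real) \<Rightarrow> real \<Rightarrow> real" where
  "conv g w t = (LINT s:{0..t}|lebesgue. g (t - s) * w s)"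

end

theory Submission
  imports Defs
begin

text \<open>
  Write J(r) for the integral of g over (0, r) and choose R with m J(R) \<le> 1/2. Let K bound \<phi>
  essentially and choose d with M(K) J(d) \<le> 1/2. Once \<phi> \<le> a + 1 holds a.e. below T = n d, the
  hypothesis gives \<phi>(t) \<le> a + m J(t) + M(K) J(t - T) \<le> a + 1 for a.e. t below min(R, S) and T + d.
  As d does not depend on n, finitely many such steps cover (0, min(R, S)).
\<close>


text \<open>An affine map of slope -1 has scaling factor 1, so reflection preserves the measure.
  This justifies substituting \<open>t - s\<close> for \<open>s\<close> in the convolution.\<close>

lemma
  fixes t :: real
  shows measurable_reflect_shift: "(\<lambda>x. t - x) \<in> lebesgue \<rightarrow>\<^sub>M lebesgue"
    and distr_reflect_shift: "distr lebesgue lebesgue (\<lambda>x. t - x) = lebesgue"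
proof -
  show "(\<lambda>x. t - x) \<in> lebesgue \<rightarrow>\<^sub>M lebesgue"
    using lebesgue_affine_measurable[of "\<lambda>_::real. -1" t] by simp
  have "lebesgue = density (distr lebesgue lebesgue (\<lambda>x. t + (-1) * x)) (\<lambda>_. ennreal \<bar>- 1\<bar>)"
    by (rule lebesgue_real_affine) simp
  also have "\<dots> = distr lebesgue lebesgue (\<lambda>x. t - x)"
    by (simp add: density_1)
  finally show "distr lebesgue lebesgue (\<lambda>x. t - x) = lebesgue" ..
qed

lemma AE_lebesgue_reflect_shift:
  fixes t :: real
  assumes "AE x in lebesgue. P x"
  shows "AE x in lebesgue. P (t - x)"
  using assms AE_distrD[OF measurable_reflect_shift[of t], of P]
  by (simp only: distr_reflect_shift)

lemma
  fixes f :: "real \<Rightarrow> real" and t :: real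
  assumes f: "integrable lebesgue f"
  shows integrable_lebesgue_reflect_shift: "integrable lebesgue (\<lambda>x. f (t - x))"
    and integral_lebesgue_reflect_shift: "(LINT x|lebesgue. f (t - x)) = (LINT x|lebesgue. f x)"
proof -
  show "integrable lebesgue (\<lambda>x. f (t - x))"
    using integrable_distr[OF measurable_reflect_shift[of t], of f] f
    by (simp only: distr_reflect_shift)
  show "(LINT x|lebesgue. f (t - x)) = (LINT x|lebesgue. f x)"
    using integral_distr[OF measurable_reflect_shift[of t] borel_measurable_integrable[OF f]]
    by (simp only: distr_reflect_shift)
qed

lemma L1_loc_set_integrable:
  assumes "g \<in> L1_loc {0..}" and "0 \<le> c"
  shows "set_integrable lebesgue {c..r} g"
proof -
  have "compact {c..r}" "{c..r} \<subseteq> {0..}"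
    using assms(2) by auto
  with assms(1) show ?thesis
    unfolding L1_loc_def by blast
qed

text \<open>The bound \<open>r\<close> may be negative: then the interval is empty and the left side
  is 0. Such bounds occur for times before the start of a step.\<close>

lemma set_integral_mono_upper:
  assumes "g \<in> L1_loc {0..}" and "AE t in lebesgue. 0 \<le> t \<longrightarrow> 0 \<le> g t" and "r \<le> r'"
  shows "(LINT u:{0..r}|lebesgue. g u) \<le> (LINT u:{0..r'}|lebesgue. g u)"
  unfolding set_lebesgue_integral_def
proof (rule integral_mono_AE)
  show "AE u in lebesgue. indicator {0..r} u *\<^sub>R g u \<le> indicator {0..r'} u *\<^sub>R g u"
    using assms(2) by eventually_elim (use assms(3) in \<open>auto simp: indicator_def\<close>)
qed (use L1_loc_set_integrable[OF assms(1), of 0] in \<open>auto simp: set_integrable_def\<close>)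

text \<open>The indefinite integral of \<open>g\<close> is continuous and vanishes at 0. The lemma
  yields both the time \<open>R\<close> (with \<open>c = m\<close>) and the step length
  \<open>d\<close> (with \<open>c = M K\<close>).\<close>

lemma small_set_integral:
  assumes g: "g \<in> L1_loc {0..}" and "0 < e"
  shows "\<exists>r>0. c * (LINT u:{0..r}|lebesgue. g u) \<le> (e::real)"
proof -
  define J where "J r = integral {0..r} g" for r :: real
  have J: "(LINT u:{0..r}|lebesgue. g u) = J r" for r
    unfolding J_def using L1_loc_set_integrable[OF g, of 0]
    by (intro set_lebesgue_integral_eq_integral) simp
  have "g integrable_on {0..1}"
    using L1_loc_set_integrable[OF g, of 0] by (intro set_lebesgue_integral_eq_integral) simp
  then have "continuous_on {0..1} J"
    unfolding J_def by (rule indefinite_integral_continuous_1)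
  then have "continuous_on {0..1} (\<lambda>r. c * J r)"
    by (intro continuous_intros)
  then have "\<forall>e>0. \<exists>d>0. \<forall>r\<in>{0..1}. dist r 0 < d \<longrightarrow> dist (c * J r) (c * J 0) < e"
    unfolding continuous_on_iff by (rule bspec) simp
  then obtain d where d: "0 < d" "\<And>r. r \<in> {0..1} \<Longrightarrow> dist r 0 < d \<Longrightarrow> dist (c * J r) (c * J 0) < e"
    using \<open>0 < e\<close> by blast
  \<comment> \<open>The witness stays in \<open>{0..1}\<close>, where continuity is known, and is
    strictly closer to 0 than \<open>d\<close>.\<close>
  have "dist (c * J (min 1 (d/2))) (c * J 0) < e"
    using d(1) by (intro d(2)) (auto simp: dist_real_def)
  then have "c * J (min 1 (d/2)) \<le> e"
    by (simp add: J_def dist_real_def)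
  with d(1) have "0 < min 1 (d/2) \<and> c * (LINT u:{0..min 1 (d/2)}|lebesgue. g u) \<le> e"
    unfolding J by simp
  then show ?thesis ..
qed

text \<open>After reflection the weight \<open>m\<close> meets all of \<open>{0..t}\<close>, while
  the extra weight \<open>k\<close>, present only for \<open>s\<close> \<ge> \<open>T\<close>, meets
  arguments \<open>t - s\<close> \<le> \<open>t - T\<close>. If \<open>t < T\<close>, the second
  integral is over the empty set.\<close>

lemma conv_le_split:
  fixes g w :: "real \<Rightarrow> real"
  assumes g: "g \<in> L1_loc {0..}" and gnn: "AE t in lebesgue. 0 \<le> t \<longrightarrow> 0 \<le> g t"
    and "0 \<le> m" "0 \<le> k" "0 \<le> T"
    and w: "AE s in lebesgue. s \<in> {0<..<t} \<longrightarrow> w s \<le> m + (if T \<le> s then k else 0)"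
  shows "conv g w t \<le> m * (LINT u:{0..t}|lebesgue. g u) + k * (LINT u:{0..t-T}|lebesgue. g u)"
proof -
  define f where "f r = (\<lambda>u. indicator {0..r} u *\<^sub>R g u)" for r
  have f: "integrable lebesgue (f r)" for r
    using L1_loc_set_integrable[OF g, of 0 r] by (simp add: set_integrable_def f_def)
  have f': "integrable lebesgue (\<lambda>s. f r (t - s))" for r
    by (rule integrable_lebesgue_reflect_shift[OF f])
  have gnn': "AE s in lebesgue. 0 \<le> t - s \<longrightarrow> 0 \<le> g (t - s)"
    by (rule AE_lebesgue_reflect_shift[OF gnn])
  \<comment> \<open>The bound on \<open>w\<close> covers only the open interval. Away from the two
    endpoints, every remaining \<open>s\<close> makes both integrands 0.\<close>
  have ends: "AE s in lebesgue. s \<noteq> 0 \<and> s \<noteq> t"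
    by (intro AE_conjI AE_completion AE_lborel_singleton)
  have "conv g w t = (LINT s|lebesgue. indicator {0..t} s *\<^sub>R (g (t - s) * w s))"
    by (simp add: conv_def set_lebesgue_integral_def)
  also have "\<dots> \<le> (LINT s|lebesgue. m * f t (t - s) + k * f (t - T) (t - s))"
  \<comment> \<open>Only the majorant has to be integrable: if the left integrand is not, its
    integral is 0 by convention, and the majorant is nonnegative.\<close>
  proof (rule integral_mono_AE')
    show "integrable lebesgue (\<lambda>s. m * f t (t - s) + k * f (t - T) (t - s))"
      by (intro Bochner_Integration.integrable_add integrable_mult_right f')
    show "AE s in lebesgue. indicator {0..t} s *\<^sub>R (g (t - s) * w s)
            \<le> m * f t (t - s) + k * f (t - T) (t - s)"
      using gnn' w ends
    proof eventually_elim
      case (elim s)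
      show ?case
      proof (cases "s \<in> {0<..<t}")
        case True
        with elim have "g (t - s) * w s \<le> g (t - s) * (m + (if T \<le> s then k else 0))"
          by (intro mult_left_mono) auto
        with True show ?thesis
          by (cases "T \<le> s") (simp_all add: f_def algebra_simps)
      next
        case False
        with elim \<open>0 \<le> T\<close> show ?thesis
          by (auto simp: f_def indicator_def)
      qed
    qed
    show "AE s in lebesgue. 0 \<le> m * f t (t - s) + k * f (t - T) (t - s)"
      using gnn' by eventually_elim (use \<open>0 \<le> m\<close> \<open>0 \<le> k\<close> in \<open>auto simp: f_def indicator_def\<close>)
  qed
  also have "\<dots> = m * (LINT s|lebesgue. f t s) + k * (LINT s|lebesgue. f (t - T) s)"
    by (simp add: f' integral_lebesgue_reflect_shift[OF f])
  finally show ?thesis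
    unfolding f_def set_lebesgue_integral_def .
qed

lemma Linfty_AE_bounded:
  assumes "\<phi> \<in> Linfty A"
  obtains K where "0 \<le> K" "AE t in lebesgue_on A. \<phi> t \<le> K"
proof -
  have "Linfty_norm A \<phi> < \<infinity>"
    using assms by (simp add: Linfty_def)
  then obtain K where K: "0 \<le> K" "Linfty_norm A \<phi> = ennreal K"
    by (cases "Linfty_norm A \<phi>") auto
  have "AE t in lebesgue_on A. ennreal \<bar>\<phi> t\<bar> \<le> ennreal K"
    unfolding K(2)[symmetric] Linfty_norm_def by (rule esssup_AE)
  then have "AE t in lebesgue_on A. \<phi> t \<le> K"
    by eventually_elim (use K(1) in auto)
  with K(1) show ?thesis by (rule that)
qed

lemma Linfty_norm_le:
  assumes "\<phi> \<in> Linfty A" "B \<subseteq> A" "AE t in lebesgue_on B. \<bar>\<phi> t\<bar> \<le> c"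
  shows "Linfty_norm B \<phi> \<le> ennreal c"
  unfolding Linfty_norm_def
proof (rule esssup_I)
  \<comment> \<open>Measurability must be carried over to \<open>B\<close>, since
    \<open>esssup\<close> of a non-measurable function is top by default.\<close>
  have "\<phi> \<in> borel_measurable (lebesgue_on B)"
    using assms(1,2) measurable_restrict_mono unfolding Linfty_def by blast
  then show "(\<lambda>x. ennreal \<bar>\<phi> x\<bar>) \<in> borel_measurable (lebesgue_on B)"
    by measurable
  show "AE x in lebesgue_on B. ennreal \<bar>\<phi> x\<bar> \<le> ennreal c"
    using assms(3) by eventually_elim (rule ennreal_leI)
qed

text \<open>The essential bound \<open>K\<close> of \<open>\<phi>\<close> influences only the step
  length \<open>d\<close>, never \<open>R\<close>. Hence \<open>R\<close> can be fixed before
  \<open>\<phi>\<close> is known.\<close>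

lemma AE_le_before_time:
  fixes g \<phi> M :: "real \<Rightarrow> real"
  assumes g: "g \<in> L1_loc {0..}" and gnn: "AE t in lebesgue. 0 \<le> t \<longrightarrow> 0 \<le> g t"
    and R: "M (a + 1) * (LINT u:{0..R}|lebesgue. g u) \<le> 1/2"
    and "0 \<le> a" and \<phi>: "\<phi> \<in> Linfty {0<..<S}"
    and \<phi>nn: "AE t in lebesgue. t \<in> {0<..<S} \<longrightarrow> 0 \<le> \<phi> t"
    and Mnn: "\<And>x. 0 \<le> x \<Longrightarrow> 0 \<le> M x" and M: "mono_on {0..} M"
    and le: "AE t in lebesgue. t \<in> {0<..<S} \<longrightarrow> \<phi> t \<le> a + conv g (\<lambda>s. M (\<phi> s)) t"
  shows "AE t in lebesgue. t \<in> {0<..<min R S} \<longrightarrow> \<phi> t \<le> a + 1"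
proof -
  obtain K where K: "0 \<le> K" "AE t in lebesgue_on {0<..<S}. \<phi> t \<le> K"
    using \<phi> by (rule Linfty_AE_bounded)
  have \<phi>K: "AE t in lebesgue. t \<in> {0<..<S} \<longrightarrow> \<phi> t \<le> K"
    using K(2) by (simp add: AE_restrict_space_iff)
  obtain d where d: "0 < d" "M K * (LINT u:{0..d}|lebesgue. g u) \<le> 1/2"
    using small_set_integral[OF g, of "1/2" "M K"] by auto
  have step: "AE t in lebesgue. t \<in> {0<..<min R S} \<and> t < real n * d \<longrightarrow> \<phi> t \<le> a + 1" for n
  proof (induction n)
    case 0
    show ?case by simp
  next
    case (Suc n)
    \<comment> \<open>Before \<open>real n * d\<close> the induction hypothesis applies. Afterwards
      only the crude bound \<open>K\<close> is available, and \<open>M (a + 1)\<close> is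
      nonnegative slack.\<close>
    have w: "AE s in lebesgue. s \<in> {0<..<min R S} \<longrightarrow>
        M (\<phi> s) \<le> M (a + 1) + (if real n * d \<le> s then M K else 0)"
      using Suc.IH \<phi>nn \<phi>K
    proof eventually_elim
      case (elim s)
      show ?case
      proof (intro impI)
        assume s: "s \<in> {0<..<min R S}"
        show "M (\<phi> s) \<le> M (a + 1) + (if real n * d \<le> s then M K else 0)"
        proof (cases "real n * d \<le> s")
          case True
          have "M (\<phi> s) \<le> M K"
            using elim s K(1) by (intro mono_onD[OF M]) auto
          with True Mnn[of "a + 1"] \<open>0 \<le> a\<close> show ?thesis by simp
        next
          case False
          then have "M (\<phi> s) \<le> M (a + 1)"
            using elim s \<open>0 \<le> a\<close> by (intro mono_onD[OF M]) auto
          with False show ?thesis by simp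
        qed
      qed
    qed
    show ?case
      using le
    proof eventually_elim
      case (elim t)
      show ?case
      proof (intro impI)
        assume t: "t \<in> {0<..<min R S} \<and> t < real (Suc n) * d"
        let ?J = "\<lambda>r. LINT u:{0..r}|lebesgue. g u"
        have "conv g (\<lambda>s. M (\<phi> s)) t \<le> M (a + 1) * ?J t + M K * ?J (t - real n * d)"
        proof (rule conv_le_split[OF g gnn])
          show "AE s in lebesgue. s \<in> {0<..<t} \<longrightarrow>
              M (\<phi> s) \<le> M (a + 1) + (if real n * d \<le> s then M K else 0)"
            using w by eventually_elim (use t in auto)
        qed (use Mnn K(1) \<open>0 \<le> a\<close> d(1) in auto)
        \<comment> \<open>Here \<open>t < R\<close>, and \<open>t < real (Suc n) * d\<close> leaves
          less than \<open>d\<close> after \<open>real n * d\<close>. Each term is then at most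
          1/2.\<close>
        also have "\<dots> \<le> M (a + 1) * ?J R + M K * ?J d"
          using t Mnn K(1) \<open>0 \<le> a\<close>
          by (intro add_mono mult_left_mono set_integral_mono_upper[OF g gnn])
            (auto simp: algebra_simps)
        also have "\<dots> \<le> 1"
          using R d(2) by simp
        finally show "\<phi> t \<le> a + 1"
          using elim t by auto
      qed
    qed
  qed
  obtain n where "R < real n * d"
    using reals_Archimedean3[OF d(1)] by blast
  show ?thesis
    using step[of n] by eventually_elim (use \<open>R < real n * d\<close> in auto)
qed

text \<open>The order of quantifiers expresses the dependence of \<open>R\<close>: it is chosen
  after \<open>g\<close> and the value \<open>m\<close> of \<open>M (a + 1)\<close>, but before
  \<open>S\<close>, \<open>a\<close>, \<open>\<phi>\<close> and \<open>M\<close>.\<close>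

theorem lemma5p1:
  fixes g :: "real \<Rightarrow> real" and m :: real
  assumes "g \<in> L1_loc {0..}"
    and "AE t in lebesgue_on {0..}. 0 \<le> g t"
  shows "\<exists>R>0. \<forall>(S::real) (a::real) (\<phi>::real \<Rightarrow> real) (M::real \<Rightarrow> real).
           0 < S \<and> 0 \<le> a
         \<and> \<phi> \<in> Linfty {0<..<S} \<and> (AE t in lebesgue_on {0<..<S}. 0 \<le> \<phi> t)
         \<and> (\<forall>x\<ge>0. 0 \<le> M x) \<and> mono_on {0..} M \<and> M (a + 1) = m
         \<and> (AE t in lebesgue_on {0<..<S}. \<phi> t \<le> a + conv g (\<lambda>s. M (\<phi> s)) t)
         \<longrightarrow> Linfty_norm {0<..<min R S} \<phi> \<le> ennreal (a + 1)"
proof -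
  have gnn: "AE t in lebesgue. 0 \<le> t \<longrightarrow> 0 \<le> g t"
    using assms(2) by (simp add: AE_restrict_space_iff)
  obtain R where R: "0 < R" "m * (LINT u:{0..R}|lebesgue. g u) \<le> 1/2"
    using small_set_integral[OF assms(1), of "1/2" m] by auto
  show ?thesis
  proof (intro exI[of _ R] conjI allI impI)
    fix S a :: real and \<phi> M :: "real \<Rightarrow> real"
    assume *: "0 < S \<and> 0 \<le> a
         \<and> \<phi> \<in> Linfty {0<..<S} \<and> (AE t in lebesgue_on {0<..<S}. 0 \<le> \<phi> t)
         \<and> (\<forall>x\<ge>0. 0 \<le> M x) \<and> mono_on {0..} M \<and> M (a + 1) = m
         \<and> (AE t in lebesgue_on {0<..<S}. \<phi> t \<le> a + conv g (\<lambda>s. M (\<phi> s)) t)"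
    then have \<phi>nn: "AE t in lebesgue. t \<in> {0<..<S} \<longrightarrow> 0 \<le> \<phi> t"
      and le: "AE t in lebesgue. t \<in> {0<..<S} \<longrightarrow> \<phi> t \<le> a + conv g (\<lambda>s. M (\<phi> s)) t"
      by (simp_all add: AE_restrict_space_iff)
    have "AE t in lebesgue. t \<in> {0<..<min R S} \<longrightarrow> \<phi> t \<le> a + 1"
      by (rule AE_le_before_time[where g = g and M = M])
        (use assms(1) gnn \<phi>nn le * R(2) in simp_all)
    with \<phi>nn have "AE t in lebesgue. t \<in> {0<..<min R S} \<longrightarrow> \<bar>\<phi> t\<bar> \<le> a + 1"
      by eventually_elim auto
    then have bound: "AE t in lebesgue_on {0<..<min R S}. \<bar>\<phi> t\<bar> \<le> a + 1"
      by (simp add: AE_restrict_space_iff)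
    have "\<phi> \<in> Linfty {0<..<S}"
      using * by blast
    then show "Linfty_norm {0<..<min R S} \<phi> \<le> ennreal (a + 1)"
      by (rule Linfty_norm_le[OF _ _ bound]) auto
  qed (rule R(1))
qed

end
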